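(* For every integer $n\ge 76$, every integer in the interval $\left[-\binom{\lfloor(2n+1)/3\rfloor}{2},\ \binom{\lfloor(2n+1)/3\rfloor}{2}\right]$ is an eigenvalue of the transposition graph $\mathrm{Cay}(S_n,T_n)$.
   Context: $S_n$ is the symmetric group on $\{1,\dots,n\}$ and $T_n\subseteq S_n$ is the set of all transpositions. The transposition graph $\mathrm{Cay}(S_n,T_n)$ is the Cayley graph with vertex set $S_n$ in which $f,g\in S_n$ are adjacent iff $fg^{-1}\in T_n$. Its eigenvalues are the eigenvalues of its adjacency matrix. *)

theory Defs
  imports "HOL-Algebra.Sym_Groups" "Jordan_Normal_Form.Char_Poly" "Graph_Theory.Pair_Digraph"
begin

definition transpositions :: "nat \<Rightarrow> (nat \<Rightarrow> nat) set" where
  "transpositions n = {transpose a b | a b. a \<in> {1..n} \<and> b \<in> {1..n} \<and> a \<noteq> b}"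

text \<open>Undirected graphs are represented as symmetric digraphs:
  each edge corresponds to a pair of opposite arcs.\<close>

definition cayley_graph :: "('a, 'b) monoid_scheme \<Rightarrow> 'a set \<Rightarrow> 'a pair_pre_digraph" where
  "cayley_graph G S =
     \<lparr>pverts = carrier G,
      parcs = {(f, g). f \<in> carrier G \<and> g \<in> carrier G \<and> f \<otimes>\<^bsub>G\<^esub> inv\<^bsub>G\<^esub> g \<in> S}\<rparr>"

definition transposition_graph :: "nat \<Rightarrow> (nat \<Rightarrow> nat) pair_pre_digraph" where
  "transposition_graph n = cayley_graph (sym_group n) (transpositions n)"

definition adjacency_matrix :: "'a pair_pre_digraph \<Rightarrow> 'a list \<Rightarrow> real mat" where
  "adjacency_matrix X vs =
     mat (length vs) (length vs) (\<lambda>(i, j). if (vs ! i, vs ! j) \<in> parcs X then 1 else 0)"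

definition graph_eigenvalue :: "'a pair_pre_digraph \<Rightarrow> real \<Rightarrow> bool" where
  "graph_eigenvalue X k \<longleftrightarrow>
     (\<exists>vs. distinct vs \<and> set vs = pverts X \<and> eigenvalue (adjacency_matrix X vs) k)"

text \<open>The choice of the vertex ordering is immaterial: eigenvectors for one ordering are
  permuted into eigenvectors for any other.\<close>

lemma eigenvalue_adjacency_matrix_reorder:
  assumes vs: "distinct vs" "set vs = V" and ws: "distinct ws" "set ws = V"
    and ev: "eigenvalue (adjacency_matrix X vs) k"
  shows "eigenvalue (adjacency_matrix X ws) k"
proof -
  let ?A = "\<lambda>us i j. (if (us ! i, us ! j) \<in> parcs X then 1 else 0 :: real)"
  define N where "N = length vs"
  have lenw: "length ws = N"
    using vs ws by (metis N_def distinct_card)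
  have "\<exists>p. \<forall>i<N. p i < N \<and> vs ! p i = ws ! i"
  proof -
    have "\<forall>i<N. \<exists>j<N. vs ! j = ws ! i"
      by (metis N_def in_set_conv_nth lenw vs(2) ws(2))
    then show ?thesis by metis
  qed
  then obtain p where p: "\<And>i. i < N \<Longrightarrow> p i < N" "\<And>i. i < N \<Longrightarrow> vs ! p i = ws ! i" by blast
  have inj: "inj_on p {0..<N}"
    by (rule inj_onI) (metis atLeastLessThan_iff lenw nth_eq_iff_index_eq p(2) ws(1))
  have bij: "bij_betw p {0..<N} {0..<N}"
    unfolding bij_betw_def using inj p(1)
    by (metis atLeastLessThan_iff endo_inj_surj finite_atLeastLessThan image_subsetI zero_le)
  from ev obtain v where v: "v \<in> carrier_vec N" "v \<noteq> 0\<^sub>v N"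
      "adjacency_matrix X vs *\<^sub>v v = k \<cdot>\<^sub>v v"
    unfolding eigenvalue_def eigenvector_def adjacency_matrix_def N_def by auto
  have row: "(\<Sum>j = 0..<N. ?A vs i j * v $ j) = k * v $ i" if "i < N" for i
  proof -
    have "(adjacency_matrix X vs *\<^sub>v v) $ i = (k \<cdot>\<^sub>v v) $ i" using v(3) by simp
    then show ?thesis using that v(1)
      by (simp add: adjacency_matrix_def N_def scalar_prod_def)
  qed
  define w where "w = vec N (\<lambda>i. v $ p i)"
  have "w \<noteq> 0\<^sub>v N"
  proof
    assume "w = 0\<^sub>v N"
    then have z: "v $ p i = 0" if "i < N" for i
      using that by (metis index_vec index_zero_vec(1) w_def)
    have "v $ j = 0" if "j < N" for j
    proof -
      have "j \<in> p ` {0..<N}" using bij that by (simp add: bij_betw_def)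
      then show ?thesis using z by auto
    qed
    then have "v = 0\<^sub>v N" using v(1) by (intro eq_vecI) auto
    then show False using v(2) by simp
  qed
  moreover have "adjacency_matrix X ws *\<^sub>v w = k \<cdot>\<^sub>v w"
  proof (rule eq_vecI)
    fix i assume "i < dim_vec (k \<cdot>\<^sub>v w)"
    then have i: "i < N" by (simp add: w_def)
    have "(adjacency_matrix X ws *\<^sub>v w) $ i = (\<Sum>j = 0..<N. ?A ws i j * v $ p j)"
      using i lenw by (simp add: adjacency_matrix_def w_def scalar_prod_def)
    also have "\<dots> = (\<Sum>j = 0..<N. ?A vs (p i) (p j) * v $ p j)"
      using i p by (intro sum.cong) auto
    also have "\<dots> = (\<Sum>j = 0..<N. ?A vs (p i) j * v $ j)"
      by (rule sum.reindex_bij_betw[OF bij])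
    also have "\<dots> = k * v $ p i" using row p(1) i by blast
    finally show "(adjacency_matrix X ws *\<^sub>v w) $ i = (k \<cdot>\<^sub>v w) $ i"
      using i by (simp add: w_def)
  qed (simp add: adjacency_matrix_def w_def lenw)
  ultimately show ?thesis
    unfolding eigenvalue_def eigenvector_def
    by (intro exI[of _ w]) (simp add: adjacency_matrix_def w_def lenw carrier_vecI)
qed

end

theory Submission
  imports Defs
begin

text \<open>For every Young diagram with \<open>n\<close> cells, its content sum (column minus row, summed over all
  cells) is an eigenvalue: the column-antisymmetrized indicator of the row stabilizer of a tableau is
  an eigenvector, because a transposition within a row fixes it, one within a column negates it, and
  every other transposition contributes zero.

  It remains to realize all integers of the interval as content sums. Wrapping a hook with \<open>h\<close> cells
  around a diagram adds an amount that grows by \<open>h\<close> whenever one cell moves from the leg to the arm.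
  Hence if the content sums of the diagrams with \<open>n'\<close> cells contain an interval of \<open>h\<close> integers, those
  with \<open>n' + h\<close> cells contain a much longer one. For \<open>n \<ge> 533\<close> this is an induction from \<open>n div 7\<close> to
  \<open>n\<close>; smaller \<open>n\<close> reduce to explicit lists of partitions of 13, 17 and 23.\<close>

section \<open>Content sums of Young diagrams\<close>

definition young_diagram :: "(nat \<times> nat) set \<Rightarrow> bool" where
  "young_diagram Y \<longleftrightarrow> finite Y \<and> (\<forall>i j i' j'. (i, j) \<in> Y \<longrightarrow> i' \<le> i \<longrightarrow> j' \<le> j \<longrightarrow> (i', j') \<in> Y)"

definition content_sum :: "(nat \<times> nat) set \<Rightarrow> int" where
  "content_sum Y = (\<Sum>(i, j)\<in>Y. int j - int i)"

text \<open>The box is only an upper bound. It is recorded because a hook fits around the diagram as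
  soon as its leg and arm exceed the box.\<close>

definition box_content :: "nat \<Rightarrow> nat \<Rightarrow> nat \<Rightarrow> int \<Rightarrow> bool" where
  "box_content a b n s \<longleftrightarrow>
     (\<exists>Y. young_diagram Y \<and> Y \<subseteq> {..<a} \<times> {..<b} \<and> card Y = n \<and> content_sum Y = s)"

lemma box_contentI:
  assumes "young_diagram Y" "Y \<subseteq> {..<a} \<times> {..<b}" "card Y = n" "content_sum Y = s"
  shows "box_content a b n s"
  using assms unfolding box_content_def by blast

lemma box_contentE:
  assumes "box_content a b n s"
  obtains Y where "young_diagram Y" "Y \<subseteq> {..<a} \<times> {..<b}" "card Y = n" "content_sum Y = s"
  using assms unfolding box_content_def by blast

lemma box_content_mono:
  assumes "box_content a b n s" "a \<le> a'" "b \<le> b'"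
  shows "box_content a' b' n s"
proof -
  have "{..<a} \<times> {..<b} \<subseteq> {..<a'} \<times> {..<b'}"
    using assms by auto
  with assms(1) show ?thesis
    unfolding box_content_def by blast
qed

lemma box_content_empty: "box_content 0 0 0 0"
  unfolding box_content_def young_diagram_def content_sum_def by (intro exI[of _ "{}"]) auto

lemma box_content_transpose:
  assumes "box_content a b n s"
  shows "box_content b a n (- s)"
proof -
  obtain Y where Y: "young_diagram Y" "Y \<subseteq> {..<a} \<times> {..<b}" "card Y = n" "content_sum Y = s"
    using assms by (rule box_contentE)
  have inj: "inj_on prod.swap Y"
    by simp
  show ?thesis
  proof (rule box_contentI)
    show "young_diagram (prod.swap ` Y)"
      using Y(1) unfolding young_diagram_def by force
    show "prod.swap ` Y \<subseteq> {..<b} \<times> {..<a}"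
      using Y(2) by auto
    show "card (prod.swap ` Y) = n"
      using Y(3) card_image[OF inj] by simp
    have "content_sum (prod.swap ` Y) = (\<Sum>(i, j)\<in>Y. int i - int j)"
      unfolding content_sum_def by (subst sum.reindex[OF inj]) (simp add: case_prod_unfold)
    also have "\<dots> = - content_sum Y"
      unfolding content_sum_def by (simp add: sum_negf[symmetric] case_prod_unfold)
    finally show "content_sum (prod.swap ` Y) = - s"
      using Y(4) by simp
  qed
qed

section \<open>Adding rows and hooks\<close>

lemma sum_int_lessThan: "(\<Sum>j<k. int j) = int (k choose 2)"
  by (induction k) (simp_all add: numeral_2_eq_2)

lemma twice_choose_two: "2 * int (k choose 2) = int k * (int k - 1)"
  by (induction k) (simp_all add: numeral_2_eq_2 algebra_simps)

text \<open>The new row goes on top: its contents are 0, ..., k - 1, and each of the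
  \<open>n\<close> old cells moves down by one and loses 1.\<close>

lemma box_content_add_row:
  assumes "box_content a b n s" "b \<le> k"
  shows "box_content (Suc a) k (n + k) (s + int (k choose 2) - int n)"
proof -
  obtain Y where Y: "young_diagram Y" "Y \<subseteq> {..<a} \<times> {..<b}" "card Y = n" "content_sum Y = s"
    using assms(1) by (rule box_contentE)
  define f where "f = (\<lambda>(i, j::nat). (Suc i, j))"
  define X where "X = {0::nat} \<times> {..<k}"
  have inj: "inj_on f Y"
    by (auto simp: inj_on_def f_def)
  have fin: "finite X" "finite (f ` Y)" and disj: "X \<inter> f ` Y = {}"
    using Y(1) by (auto simp: X_def f_def young_diagram_def)
  show ?thesis
  proof (rule box_contentI)
    have mem: "(i, j) \<in> X \<union> f ` Y \<longleftrightarrow> i = 0 \<and> j < k \<or> (\<exists>i'. i = Suc i' \<and> (i', j) \<in> Y)" for i j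
      by (auto simp: X_def f_def image_iff split: prod.splits)
    have "(i', j') \<in> X \<union> f ` Y" if ij: "(i, j) \<in> X \<union> f ` Y" "i' \<le> i" "j' \<le> j" for i j i' j'
    proof (cases i')
      case 0
      have "j < k"
        using ij(1) Y(2) assms(2) unfolding mem by auto
      with 0 ij(3) show ?thesis
        unfolding mem by simp
    next
      case (Suc i0)
      then obtain i1 where "i = Suc i1" "(i1, j) \<in> Y"
        using ij(1,2) unfolding mem by auto
      with Suc ij(2,3) Y(1) show ?thesis
        unfolding mem young_diagram_def by (metis Suc_le_mono)
    qed
    with fin show "young_diagram (X \<union> f ` Y)"
      unfolding young_diagram_def by blast
    show "X \<union> f ` Y \<subseteq> {..<Suc a} \<times> {..<k}"
      using Y(2) assms(2) by (force simp: X_def f_def)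
    show "card (X \<union> f ` Y) = n + k"
      using Y(3) card_image[OF inj] by (simp add: card_Un_disjoint[OF fin disj]) (simp add: X_def)
    have "(\<Sum>(i, j)\<in>X. int j - int i) = int (k choose 2)"
      by (simp add: X_def sum.cartesian_product[symmetric] sum_int_lessThan)
    moreover have "(\<Sum>(i, j)\<in>f ` Y. int j - int i) = (\<Sum>(i, j)\<in>Y. (int j - int i) - 1)"
      by (subst sum.reindex[OF inj]) (auto simp: f_def intro!: sum.cong)
    moreover have "\<dots> = s - int n"
      using Y(3,4) by (simp add: content_sum_def case_prod_unfold sum_subtractf)
    ultimately show "content_sum (X \<union> f ` Y) = s + int (k choose 2) - int n"
      unfolding content_sum_def by (simp add: sum.union_disjoint[OF fin disj])
  qed
qed

text \<open>Wrapping a hook around a diagram moves every cell along its diagonal, so contents simply add.\<close>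

lemma box_content_add_hook:
  assumes "box_content a b n s" "a < l" "b < k"
  shows "box_content l k (n + (k + l - 1)) (s + int (k choose 2) - int (l choose 2))"
proof -
  obtain l' where l: "l = Suc l'"
    using assms(2) by (cases l) auto
  \<comment> \<open>A column on the left is a row on top of the transposed diagram. The leg is added
    first and without the corner cell, which then comes with the arm; hence \<open>l'\<close>
    instead of \<open>l\<close>.\<close>
  have "box_content (Suc b) l' (n + l') (- s + int (l' choose 2) - int n)"
    using assms l by (intro box_content_add_row[OF box_content_transpose]) auto
  then have "box_content l' (Suc b) (n + l') (- (- s + int (l' choose 2) - int n))"
    by (rule box_content_transpose)
  then have "box_content (Suc l') k (n + l' + k)
      (- (- s + int (l' choose 2) - int n) + int (k choose 2) - int (n + l'))"
    using assms by (intro box_content_add_row[where b = "Suc b"]) auto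
  then show ?thesis
    by (simp add: l numeral_2_eq_2 algebra_simps)
qed

section \<open>Partitions as lists of row lengths\<close>

text \<open>Row lengths are integers and contents are doubled so that \<open>code_simp\<close> can check tables of
  partitions in binary arithmetic without division.\<close>

fun rows_ok :: "int list \<Rightarrow> bool" where
  "rows_ok [] \<longleftrightarrow> True"
| "rows_ok [k] \<longleftrightarrow> 0 \<le> k"
| "rows_ok (k # k' # ks) \<longleftrightarrow> k' \<le> k \<and> rows_ok (k' # ks)"

fun twice_content :: "int list \<Rightarrow> int" where
  "twice_content [] = 0"
| "twice_content (k # ks) = k * (k - 1) - 2 * sum_list ks + twice_content ks"

lemma rows_ok_nonneg: "rows_ok ks \<Longrightarrow> 0 \<le> sum_list ks \<and> (ks \<noteq> [] \<longrightarrow> 0 \<le> hd ks)"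
  by (induction ks rule: rows_ok.induct) auto

text \<open>\<open>twice_content\<close> doubles the recursion of
  \<open>box_content_add_row\<close>, so the diagram is built from its last row upwards.\<close>

lemma box_content_rows:
  assumes "rows_ok ks"
  shows "\<exists>s. 2 * s = twice_content ks \<and>
    box_content (length ks) (if ks = [] then 0 else nat (hd ks)) (nat (sum_list ks)) s"
  using assms
proof (induction ks)
  case Nil
  then show ?case
    using box_content_empty by simp
next
  case (Cons k ks)
  have ok: "rows_ok ks"
    using Cons.prems by (cases ks) simp_all
  have le: "(if ks = [] then 0 else nat (hd ks)) \<le> nat k"
    using Cons.prems by (cases ks) (simp_all add: nat_mono)
  have "0 \<le> k"
    using rows_ok_nonneg[OF Cons.prems] by simp
  from Cons.IH[OF ok] obtain s where s: "2 * s = twice_content ks"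
    "box_content (length ks) (if ks = [] then 0 else nat (hd ks)) (nat (sum_list ks)) s"
    by blast
  have nn: "0 \<le> sum_list ks"
    using rows_ok_nonneg[OF ok] by blast
  let ?s = "s + int (nat k choose 2) - int (nat (sum_list ks))"
  have "box_content (Suc (length ks)) (nat k) (nat (sum_list ks) + nat k) ?s"
    by (rule box_content_add_row[OF s(2) le])
  moreover have "nat (sum_list ks) + nat k = nat (sum_list (k # ks))"
    using nn \<open>0 \<le> k\<close> by simp
  moreover have "2 * ?s = twice_content (k # ks)"
    using twice_choose_two[of "nat k"] s(1) nn \<open>0 \<le> k\<close> by (simp add: algebra_simps)
  ultimately show ?case
    by (intro exI[of _ ?s]) simp
qed

definition rows_check :: "int \<Rightarrow> int \<Rightarrow> int \<Rightarrow> int \<Rightarrow> int list \<Rightarrow> bool" where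
  "rows_check a b n s ks \<longleftrightarrow> rows_ok ks \<and> int (length ks) \<le> a \<and> (ks = [] \<or> hd ks \<le> b) \<and>
     sum_list ks = n \<and> twice_content ks = 2 * s"

lemma box_content_rows_check:
  assumes "rows_check a b n s ks"
  shows "box_content (nat a) (nat b) (nat n) s"
proof -
  have "rows_ok ks" and c: "int (length ks) \<le> a" "ks = [] \<or> hd ks \<le> b"
    "sum_list ks = n" "twice_content ks = 2 * s"
    using assms unfolding rows_check_def by auto
  from box_content_rows[OF this(1)] c(3,4)
  have "box_content (length ks) (if ks = [] then 0 else nat (hd ks)) (nat n) s"
    by auto
  then show ?thesis
    by (rule box_content_mono) (use c in auto)
qed

lemma box_content_table:
  assumes "list_all2 (rows_check a b n) [p..q] tab" "s \<in> {p..q}"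
  shows "box_content (nat a) (nat b) (nat n) s"
proof -
  from assms(2) have "s \<in> set [p..q]"
    by simp
  with assms(1) obtain ks where "rows_check a b n s ks"
    by (metis in_set_conv_nth list_all2_nthD)
  then show ?thesis
    by (rule box_content_rows_check)
qed

section \<open>Tables of partitions of 13, 17 and 23\<close>

text \<open>Only nonnegative contents are tabulated; the box is square, so transposition supplies
  the negative ones.\<close>

lemma box_content_13:
  assumes "\<bar>s\<bar> \<le> 12"
  shows "box_content 6 6 13 s"
proof -
  have "list_all2 (rows_check 6 6 13) [0..12]
    [[4,4,3,2], [6,3,1,1,1,1], [5,3,3,2], [4,4,4,1], [5,4,2,2], [6,3,2,1,1], [5,4,3,1], [6,3,2,2],
     [6,4,1,1,1], [6,3,3,1], [5,4,4], [6,4,2,1], [5,5,3]]"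
    by code_simp
  from box_content_table[OF this, of "\<bar>s\<bar>"] box_content_transpose[of 6 6 13 "\<bar>s\<bar>"] assms
  show ?thesis
    by (cases "0 \<le> s") auto
qed

lemma box_content_17:
  assumes "\<bar>s\<bar> \<le> 29"
  shows "box_content 8 8 17 s"
proof -
  have "list_all2 (rows_check 8 8 17) [0..29]
    [[5,5,3,2,2], [7,3,2,2,2,1], [6,4,3,2,2], [6,5,2,2,1,1], [5,4,4,4], [6,5,2,2,2], [7,3,3,2,2],
     [5,5,4,3], [7,4,2,2,2], [6,4,4,3], [5,5,5,2], [6,5,3,3], [6,6,2,2,1], [6,5,4,2], [7,4,3,3],
     [8,4,2,1,1,1], [7,4,4,2], [6,5,5,1], [7,5,3,2], [8,3,3,3], [8,4,3,1,1], [7,5,4,1], [8,4,3,2],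
     [8,5,2,1,1], [6,6,5], [8,5,2,2], [7,5,5], [8,5,3,1], [7,6,4], [7,7,2,1]]"
    by code_simp
  from box_content_table[OF this, of "\<bar>s\<bar>"] box_content_transpose[of 8 8 17 "\<bar>s\<bar>"] assms
  show ?thesis
    by (cases "0 \<le> s") auto
qed

lemma box_content_17_9:
  assumes "s \<in> {30..32}"
  shows "box_content 8 9 17 s"
proof -
  have "list_all2 (rows_check 8 9 17) [30..32] [[9,4,2,2], [8,5,4], [7,7,3]]"
    by code_simp
  from box_content_table[OF this assms] show ?thesis
    by simp
qed

lemma box_content_23_6:
  assumes "\<bar>s\<bar> \<le> 12"
  shows "box_content 6 6 23 s"
proof -
  have "list_all2 (rows_check 6 6 23) [0..12]
    [[6,6,4,3,2,2], [5,5,5,5,3], [6,5,4,4,4], [6,6,5,2,2,2], [6,6,4,4,2,1], [6,5,5,4,3],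
     [6,6,5,3,2,1], [6,6,4,4,3], [6,5,5,5,2], [6,6,5,3,3], [6,6,6,2,2,1], [6,6,5,4,2],
     [6,6,6,3,1,1]]"
    by code_simp
  from box_content_table[OF this, of "\<bar>s\<bar>"] box_content_transpose[of 6 6 23 "\<bar>s\<bar>"] assms
  show ?thesis
    by (cases "0 \<le> s") auto
qed

text \<open>Few rows and many columns are preferred: the upper end of a sweep depends on the number
  of rows, whereas columns only have to leave room for the hook.\<close>

lemma box_content_23_9:
  assumes "s \<in> {13..51}"
  shows "box_content 6 9 23 s"
proof -
  have "list_all2 (rows_check 6 9 23) [13..51]
    [[8,4,4,4,3], [6,6,6,3,2], [7,6,4,4,2], [8,5,4,3,3], [7,7,3,3,3], [8,5,4,4,2], [8,6,3,3,3],
     [8,5,5,3,2], [9,4,4,3,3], [6,6,6,5], [9,5,3,3,3], [9,5,4,3,1,1], [7,6,5,5], [9,5,4,3,2],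
     [7,6,6,4], [8,5,5,5], [7,7,5,4], [8,7,4,3,1], [8,6,5,4], [7,7,6,3], [9,6,4,3,1], [8,7,4,4],
     [9,5,5,4], [8,7,5,3], [9,6,4,4], [8,7,6,1,1], [9,6,5,3], [8,8,4,3], [9,8,2,2,2], [9,7,4,3],
     [9,6,6,2], [9,8,3,2,1], [9,7,5,2], [8,7,7,1], [9,8,3,3], [8,8,6,1], [9,8,4,2], [9,7,6,1],
     [9,9,2,2,1]]"
    by code_simp
  from box_content_table[OF this assms] show ?thesis
    by simp
qed

lemma box_content_23_14:
  assumes "s \<in> {52..83}"
  shows "box_content 6 14 23 s"
proof -
  have "list_all2 (rows_check 6 14 23) [52..83]
    [[11,5,4,3], [9,8,5,1], [10,6,6,1], [8,8,7], [10,7,5,1], [9,7,7], [9,9,4,1], [9,8,6],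
     [12,4,4,3], [11,7,3,2], [10,7,6], [9,9,5], [12,5,4,2], [10,8,5], [10,9,3,1], [11,6,6],
     [12,5,5,1], [11,7,5], [10,9,4], [13,4,3,3], [12,7,2,2], [11,8,4], [12,7,3,1], [12,6,5],
     [11,9,2,1], [10,10,3], [12,7,4], [11,9,3], [12,8,2,1], [13,6,3,1], [14,3,3,3], [13,5,5]]"
    by code_simp
  from box_content_table[OF this assms] show ?thesis
    by simp
qed

section \<open>Sweeping hooks around a family of diagrams\<close>

text \<open>With \<open>h\<close> cells in the hook, shortening its leg by one raises the content sum by exactly \<open>h\<close>,
  so an interval of at least \<open>h\<close> inner contents sweeps out a long interval.\<close>

lemma box_content_sweep:
  assumes W: "\<And>s. - p \<le> s \<Longrightarrow> s \<le> q \<Longrightarrow> box_content a b n' s"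
    and h: "int h \<le> p + q + 1"
    and l: "a < l" "l \<le> m" "b + m \<le> h"
    and lower: "int h * (int h + 1 - 2 * int m) - 2 * p \<le> 2 * t"
    and upper: "2 * t \<le> int h * (int h + 1 - 2 * int l) + 2 * q"
  shows "box_content m (h + 1 - l) (n' + h) t"
  using l lower
proof (induction m rule: less_induct)
  case (less m)
  show ?case
  proof (cases "2 * t \<le> int h * (int h + 1 - 2 * int m) + 2 * q")
    case True
    define k where "k = h + 1 - m"
    have k: "k + m = h + 1" "int k = int h + 1 - int m" "b < k"
      using less.prems by (auto simp: k_def)
    \<comment> \<open>The content sum of the hook alone; by \<open>k + m = h + 1\<close> it is
      linear in \<open>m\<close>.\<close>
    define c where "c = int (k choose 2) - int (m choose 2)"
    have "2 * c = int k * (int k - 1) - int m * (int m - 1)"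
      unfolding c_def by (simp add: right_diff_distrib twice_choose_two)
    also have "\<dots> = int h * (int h + 1 - 2 * int m)"
      unfolding k(2) by (simp add: algebra_simps)
    finally have c: "2 * c = int h * (int h + 1 - 2 * int m)" .
    have "box_content a b n' (t - c)"
      using True less.prems c by (intro W) auto
    then have "box_content m k (n' + (k + m - 1)) (t - c + int (k choose 2) - int (m choose 2))"
      using k less.prems by (intro box_content_add_hook) auto
    then have "box_content m k (n' + h) t"
      using k(1) by (simp add: c_def)
    then show ?thesis
      by (rule box_content_mono) (use less.prems in \<open>auto simp: k_def\<close>)
  next
    case False
    then have "m \<noteq> l"
      using upper by auto
    then have m: "l \<le> m - 1" "m - 1 < m" "int (m - 1) = int m - 1"
      using less.prems by auto
    have "even (int h * (int h + 1 - 2 * int m))"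
      by simp
    then obtain c where c: "int h * (int h + 1 - 2 * int m) = 2 * c"
      by (rule evenE)
    then have "c + q < t"
      using False by linarith
    moreover have "int h * (int h + 1 - 2 * int (m - 1)) = 2 * c + 2 * int h"
      unfolding m(3) c[symmetric] by (simp add: algebra_simps)
    \<comment> \<open>The next interval begins at \<open>c + h - p\<close>, and
      \<open>h \<le> p + q + 1\<close> leaves no gap after \<open>c + q\<close>.\<close>
    ultimately have "int h * (int h + 1 - 2 * int (m - 1)) - 2 * p \<le> 2 * t"
      using h by linarith
    then have "box_content (m - 1) (h + 1 - l) (n' + h) t"
      using less.prems m by (intro less.IH) auto
    then show ?thesis
      by (rule box_content_mono) auto
  qed
qed

text \<open>The leg runs from \<open>a + 1\<close> to \<open>h - b\<close>, the extremes that the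
  box permits. By \<open>2 * b < h\<close> the hook with the longest leg has nonpositive content, so
  the sweep starts at or below 0.\<close>

lemma box_content_sweep_nonneg:
  assumes W: "\<And>s. - p \<le> s \<Longrightarrow> s \<le> q \<Longrightarrow> box_content a b n' s"
    and "0 \<le> p" "int h \<le> p + q + 1" "a + b < h" "2 * b < h" "0 \<le> t"
    and "2 * t \<le> int h * (int h - 1 - 2 * int a) + 2 * q"
  shows "\<exists>a b. box_content a b (n' + h) t"
proof -
  have "int h * (int h + 1 - 2 * int (h - b)) \<le> 0"
    using assms by (intro mult_nonneg_nonpos) auto
  then have "box_content (h - b) (h + 1 - (a + 1)) (n' + h) t"
    using assms by (intro box_content_sweep[where p = p and q = q and a = a and b = b]) (auto simp: algebra_simps)
  then show ?thesis
    by blast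
qed


text \<open>The bound on \<open>18 * t\<close> is what \<open>t \<le> m choose 2\<close> and \<open>3 * m \<le> 2 * n + 1\<close> give for \<open>n = n' + h\<close>;
  the last two premises make the resulting quadratic inequality in \<open>h\<close> hold from \<open>h\<^sub>0\<close> on.\<close>

lemma box_content_sweep_range:
  assumes W: "\<And>s. - p \<le> s \<Longrightarrow> s \<le> q \<Longrightarrow> box_content a b n' s"
    and "0 \<le> p" "h\<^sub>0 \<le> h" "int h \<le> p + q + 1" "a + b < h\<^sub>0" "2 * b < h\<^sub>0" "0 \<le> t"
    and t: "18 * t \<le> (2 * int (n' + h) + 1) * (2 * int (n' + h) - 2)"
    and h\<^sub>0: "7 + 18 * int a + 8 * int n' \<le> 5 * int h\<^sub>0"
      "(2 * int n' + 1) * (2 * int n' - 2) \<le>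
         int h\<^sub>0 * (5 * int h\<^sub>0 - 7 - 18 * int a - 8 * int n') + 18 * q"
  shows "\<exists>a b. box_content a b (n' + h) t"
proof -
  \<comment> \<open>The right-hand side is \<open>9 * h * (h - 1 - 2 * a)\<close> minus the terms
    with \<open>h\<close> in the bound on \<open>18 * t\<close>. Its second factor is nonnegative at
    \<open>h\<^sub>0\<close>, so the product grows from there.\<close>
  have "int h\<^sub>0 * (5 * int h\<^sub>0 - 7 - 18 * int a - 8 * int n') \<le>
      int h * (5 * int h - 7 - 18 * int a - 8 * int n')"
    using \<open>h\<^sub>0 \<le> h\<close> h\<^sub>0(1) by (intro mult_mono) auto
  then have "9 * (2 * t) \<le> 9 * (int h * (int h - 1 - 2 * int a) + 2 * q)"
    using t h\<^sub>0(2) by (simp add: algebra_simps)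
  then show ?thesis
    using assms by (intro box_content_sweep_nonneg[where p = p and q = q and a = a and b = b]) auto
qed

text \<open>A cell forces all cells above it in the first column and before it in the first row, so
  neither coordinate reaches \<open>n\<close>. This gives a box when nothing else is known about the
  diagram.\<close>

lemma box_content_card:
  assumes "box_content a b n s"
  shows "box_content n n n s"
proof -
  obtain Y where Y: "young_diagram Y" "card Y = n" "content_sum Y = s"
    using assms by (rule box_contentE)
  have "i < n \<and> j < n" if "(i, j) \<in> Y" for i j
  proof -
    have sub: "(\<lambda>i'. (i', 0)) ` {..i} \<subseteq> Y" "Pair 0 ` {..j} \<subseteq> Y" and fin: "finite Y"
      using that Y(1) unfolding young_diagram_def by auto
    show ?thesis
      using card_mono[OF fin sub(1)] card_mono[OF fin sub(2)] Y(2)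
      by (simp add: card_image inj_on_def)
  qed
  with Y show ?thesis
    by (intro box_contentI[of Y]) auto
qed

section \<open>Content ranges of the inner diagrams\<close>

lemma box_content_35:
  assumes "\<bar>s\<bar> \<le> 111"
  shows "box_content 16 16 35 s"
  using box_content_sweep[of 12 12 6 6 13 22 7 16 s] box_content_13 assms by auto

text \<open>Legs from 9 to 30 would fit; only the middle part 14 to 25 is swept, to keep the box
  small.\<close>

lemma box_content_55:
  assumes "\<bar>s\<bar> \<le> 238"
  shows "box_content 25 25 55 s"
  using box_content_sweep[of 29 29 8 8 17 38 14 25 s] box_content_17 assms by auto

lemma box_content_17_rows_8:
  assumes "- 29 \<le> s" "s \<le> 32"
  shows "box_content 8 9 17 s"
proof (cases "s \<le> 29")
  case True
  then show ?thesis
    using assms by (intro box_content_mono[OF box_content_17]) auto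
qed (use assms box_content_17_9 in auto)

text \<open>A ninth row admits the transposes of \<open>box_content_17_9\<close>. The longer range
  permits hooks of up to 65 cells instead of 62.\<close>

lemma box_content_17_rows_9:
  assumes "- 32 \<le> s" "s \<le> 32"
  shows "box_content 9 9 17 s"
proof (cases "- 29 \<le> s")
  case True
  then show ?thesis
    using assms by (intro box_content_mono[OF box_content_17_rows_8]) auto
next
  case False
  then have "box_content 9 8 17 s"
    using assms box_content_transpose[OF box_content_17_9[of "- s"]] by auto
  then show ?thesis
    by (rule box_content_mono) auto
qed

lemma box_content_23_rows_6:
  assumes "- 12 \<le> s" "s \<le> 83"
  shows "box_content 6 14 23 s"
proof -
  consider "\<bar>s\<bar> \<le> 12" | "s \<in> {13..51}" | "s \<in> {52..83}"
    using assms by (cases "s \<le> 12"; cases "s \<le> 51") auto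
  then show ?thesis
    by cases (auto intro: box_content_mono[OF box_content_23_6] box_content_mono[OF box_content_23_9]
        box_content_23_14)
qed

lemma box_content_23_rows_9:
  assumes "- 51 \<le> s" "s \<le> 83"
  shows "box_content 9 14 23 s"
proof (cases "- 12 \<le> s")
  case True
  then show ?thesis
    using assms by (intro box_content_mono[OF box_content_23_rows_6]) auto
next
  case False
  then have "box_content 9 6 23 s"
    using assms box_content_transpose[OF box_content_23_9[of "- s"]] by auto
  then show ?thesis
    by (rule box_content_mono) auto
qed

text \<open>For \<open>n = 76\<close> the sweep over diagrams with 17 cells stops at 1271.\<close>

lemma box_content_76:
  assumes "t \<in> {1272..1275}"
  shows "\<exists>a b. box_content a b 76 t"
proof (cases "t = 1272")
  case True
  \<comment> \<open>A hook with leg 8 and arm 52 adds 1298 = 1272 + 26.\<close>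
  have "rows_check 7 5 17 (- 26) [5,2,2,2,2,2,2]"
    by code_simp
  then have "box_content 7 5 17 (- 26)"
    by (auto dest: box_content_rows_check)
  from box_content_add_hook[OF this, of 8 52] True show ?thesis
    by (auto simp: choose_two)
next
  case False
  \<comment> \<open>A hook with leg 9 and arm 51 adds 1239, so the inner contents 34 to 36 yield
    1273 to 1275.\<close>
  have "list_all2 (rows_check 8 9 17) [34..36] [[8,6,3], [9,5,2,1], [9,4,4]]"
    by code_simp
  from box_content_table[OF this, of "t - 1239"] have "box_content 8 9 17 (t - 1239)"
    using assms False by auto
  from box_content_add_hook[OF this, of 9 51] show ?thesis
    by (auto simp: choose_two)
qed

section \<open>Induction on the number of cells\<close>

lemma box_content_exists:
  assumes "76 \<le> n" "0 \<le> t" "t \<le> int (((2 * n + 1) div 3) choose 2)"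
  shows "\<exists>a b. box_content a b n t"
  using assms
proof (induction n arbitrary: t rule: less_induct)
  case (less n)
  define m where "m = (2 * n + 1) div 3"
  have m: "3 * m \<le> 2 * n + 1" "2 * n \<le> 3 * m + 1"
    unfolding m_def by linarith+
  have t: "2 * t \<le> int m * (int m - 1)"
    using less.prems twice_choose_two[of m] by (simp add: m_def)
  have "(3 * int m) * (3 * int m - 3) \<le> (2 * int n + 1) * (2 * int n - 2)"
    using m less.prems by (intro mult_mono) auto
  then have t9: "18 * t \<le> (2 * int n + 1) * (2 * int n - 2)"
    using t by (simp add: algebra_simps)
  note sweep = box_content_sweep_nonneg[OF _ _ _ _ _ \<open>0 \<le> t\<close>]
    and sweep_range = box_content_sweep_range[OF _ _ _ _ _ _ \<open>0 \<le> t\<close>]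
  \<comment> \<open>Each range of several values below 533 ends at \<open>n' + p + q + 1\<close>,
    where the longest permitted hook is reached. At 76, 83 and 84 the premises of
    \<open>sweep_range\<close> fail for the chosen inner diagrams, so the exact value of
    \<open>m\<close> is used.\<close>
  consider "n = 76" | "77 \<le> n" "n \<le> 79" | "80 \<le> n" "n \<le> 82" | "n = 83" | "n = 84"
    | "85 \<le> n" "n \<le> 119" | "120 \<le> n" "n \<le> 158" | "159 \<le> n" "n \<le> 258" | "259 \<le> n" "n \<le> 532" | "533 \<le> n"
    using less.prems(1) by linarith
  then show ?case
  proof cases
    case 1
    with m have "m = 51"
      by linarith
    show ?thesis
    proof (cases "t \<le> 1271")
      case True
      then have "\<exists>a b. box_content a b (17 + 59) t"
        by (intro sweep[of 29 32 8 9]) (auto intro: box_content_17_rows_8)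
      with 1 show ?thesis
        by simp
    next
      case False
      with t 1 \<open>m = 51\<close> box_content_76[of t] show ?thesis
        by simp
    qed
  next
    case 2
    then have "\<exists>a b. box_content a b (17 + (n - 17)) t"
      using t9 by (intro sweep_range[of 29 32 8 9 _ 60]) (auto intro: box_content_17_rows_8)
    with 2 show ?thesis
      by simp
  next
    case 3
    then have "\<exists>a b. box_content a b (17 + (n - 17)) t"
      using t9 by (intro sweep_range[of 32 32 9 9 _ 63]) (auto intro: box_content_17_rows_9)
    with 3 show ?thesis
      by simp
  next
    case 4
    with m have "m = 55"
      by linarith
    with t have "\<exists>a b. box_content a b (23 + 60) t"
      by (intro sweep[of 12 83 6 14]) (auto intro: box_content_23_rows_6)
    with 4 show ?thesis
      by simp
  next
    case 5
    with m have "m = 56"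
      by linarith
    with t have "\<exists>a b. box_content a b (23 + 61) t"
      by (intro sweep[of 12 83 6 14]) (auto intro: box_content_23_rows_6)
    with 5 show ?thesis
      by simp
  next
    case 6
    then have "\<exists>a b. box_content a b (23 + (n - 23)) t"
      using t9 by (intro sweep_range[of 12 83 6 14 _ 62]) (auto intro: box_content_23_rows_6)
    with 6 show ?thesis
      by simp
  next
    case 7
    then have "\<exists>a b. box_content a b (23 + (n - 23)) t"
      using t9 by (intro sweep_range[of 51 83 9 14 _ 97]) (auto intro: box_content_23_rows_9)
    with 7 show ?thesis
      by simp
  next
    case 8
    then have "\<exists>a b. box_content a b (35 + (n - 35)) t"
      using t9 by (intro sweep_range[of 111 111 16 16 _ 124]) (auto intro: box_content_35)
    with 8 show ?thesis
      by simp
  next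
    case 9
    then have "\<exists>a b. box_content a b (55 + (n - 55)) t"
      using t9 by (intro sweep_range[of 238 238 25 25 _ 204]) (auto intro: box_content_55)
    with 9 show ?thesis
      by simp
  next
    case 10
    \<comment> \<open>With box sides \<open>n'\<close> the premises of \<open>sweep_range\<close>
      require \<open>5 * h \<ge> 26 * n' + 7\<close>, which \<open>h \<ge> 6 * n'\<close> ensures.
      The other constraint, \<open>h \<le> 2 * q + 1\<close>, is met because \<open>q\<close> is
      quadratic in \<open>n'\<close>.\<close>
    define n' where "n' = n div 7"
    define h where "h = n - n'"
    define m' where "m' = (2 * n' + 1) div 3"
    define q where "q = int (m' choose 2)"
    have n': "76 \<le> n'" "n' < n" "7 * n' \<le> n" "n \<le> 7 * n' + 6"
      using 10 unfolding n'_def by linarith+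
    have h: "n = n' + h" "6 * n' \<le> h" "h \<le> 6 * n' + 6"
      using n' unfolding h_def by linarith+
    have m': "2 * n' \<le> 3 * m' + 1"
      unfolding m'_def by linarith
    \<comment> \<open>This linear lower bound on \<open>q\<close> suffices for
      \<open>h \<le> q\<close>, since \<open>h \<le> 9 * m' + 9\<close>.\<close>
    have "50 * (int m' - 1) \<le> int m' * (int m' - 1)"
      using m' n'(1) by (intro mult_right_mono) auto
    then have "50 * (int m' - 1) \<le> 2 * q"
      by (simp add: q_def twice_choose_two)
    moreover have "h \<le> 9 * m' + 9" "51 \<le> m'"
      using m' n'(1) h(3) by linarith+
    ultimately have "int h \<le> q"
      by simp
    have W: "box_content n' n' n' s" if "- q \<le> s" "s \<le> q" for s
    proof -
      have "\<bar>s\<bar> \<le> int (((2 * n' + 1) div 3) choose 2)"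
        using that by (simp add: q_def m'_def)
      then have "\<exists>a b. box_content a b n' \<bar>s\<bar>"
        using n' by (intro less.IH) auto
      then have "box_content n' n' n' \<bar>s\<bar>"
        using box_content_card by blast
      with box_content_transpose[of n' n' n' "\<bar>s\<bar>"] show ?thesis
        by (cases "0 \<le> s") auto
    qed
    have "(2 * int n' + 1) * (2 * int n' - 2) \<le> int h * (5 * int h - 7 - 18 * int n' - 8 * int n')"
      using n'(1) h(2) by (intro mult_mono) auto
    then have "\<exists>a b. box_content a b (n' + h) t"
      using \<open>int h \<le> q\<close> n'(1) h t9 by (intro sweep_range[of q q n' n' n' h, OF W]) auto
    then show ?thesis
      using h(1) by simp
  qed
qed

section \<open>Eigenvectors of the transposition graph\<close>

lemma transpositionsE:
  assumes "\<sigma> \<in> transpositions n"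
  obtains x y where "\<sigma> = transpose x y" "x \<in> {1..n}" "y \<in> {1..n}" "x \<noteq> y"
  using assms unfolding transpositions_def by blast

lemma transpositions_permutes: "\<sigma> \<in> transpositions n \<Longrightarrow> \<sigma> permutes {1..n}"
  by (auto elim!: transpositionsE intro: permutes_swap_id)

lemma transpositions_involutory: "\<sigma> \<in> transpositions n \<Longrightarrow> \<sigma> \<circ> \<sigma> = id"
  by (auto elim!: transpositionsE)

lemma transpositions_conj:
  assumes \<sigma>: "\<sigma> \<in> transpositions n" and p: "p permutes {1..n}"
  shows "p \<circ> \<sigma> \<circ> inv' p \<in> transpositions n"
proof -
  obtain x y where xy: "\<sigma> = transpose x y" "x \<in> {1..n}" "y \<in> {1..n}" "x \<noteq> y"
    using \<sigma> by (rule transpositionsE)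
  have "p \<circ> \<sigma> = transpose (p x) (p y) \<circ> p"
    unfolding xy(1) using permutes_inj[OF p] by (auto simp: fun_eq_iff transpose_def inj_eq)
  then have "p \<circ> \<sigma> \<circ> inv' p = transpose (p x) (p y)"
    using permutes_inv_o(1)[OF p] by (simp add: comp_assoc)
  moreover have "p x \<in> {1..n}" "p y \<in> {1..n}" "p x \<noteq> p y"
    using xy p permutes_in_image[OF p] permutes_inj[OF p] by (auto simp: inj_def simp del: atLeastAtMost_iff)
  ultimately show ?thesis
    unfolding transpositions_def by blast
qed

text \<open>The transpositions are closed under conjugation, so their sum is central in the group
  algebra.\<close>

lemma sum_transpositions_comp_commute:
  assumes "p permutes {1..n}"
  shows "(\<Sum>\<sigma>\<in>transpositions n. f (p \<circ> \<sigma>)) = (\<Sum>\<sigma>\<in>transpositions n. f (\<sigma> \<circ> p))"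
proof (rule sum.reindex_bij_witness[where i = "\<lambda>\<sigma>. inv' p \<circ> \<sigma> \<circ> p" and j = "\<lambda>\<sigma>. p \<circ> \<sigma> \<circ> inv' p"])
  note inv_p = permutes_inv_o[OF assms]
  fix \<sigma> assume \<sigma>: "\<sigma> \<in> transpositions n"
  show "inv' p \<circ> (p \<circ> \<sigma> \<circ> inv' p) \<circ> p = \<sigma>" "p \<circ> (inv' p \<circ> \<sigma> \<circ> p) \<circ> inv' p = \<sigma>"
    using inv_p by (simp_all add: fun_eq_iff)
  show "f (p \<circ> \<sigma> \<circ> inv' p \<circ> p) = f (p \<circ> \<sigma>)"
    using inv_p by (simp add: comp_assoc)
  show "p \<circ> \<sigma> \<circ> inv' p \<in> transpositions n"
    by (rule transpositions_conj[OF \<sigma> assms])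
  show "inv' p \<circ> \<sigma> \<circ> p \<in> transpositions n"
    using transpositions_conj[OF \<sigma> permutes_inv[OF assms]] permutes_inv_inv[OF assms] by simp
qed

lemma parcs_transposition_graph:
  assumes "p permutes {1..n}" "g permutes {1..n}"
  shows "(p, g) \<in> parcs (transposition_graph n) \<longleftrightarrow> (\<exists>\<sigma>\<in>transpositions n. g = \<sigma> \<circ> p)"
proof -
  have "(p, g) \<in> parcs (transposition_graph n) \<longleftrightarrow> p \<circ> inv' g \<in> transpositions n"
    using assms by (simp add: transposition_graph_def cayley_graph_def sym_group_carrier sym_group_mult
        del: One_nat_def)
  also have "\<dots> \<longleftrightarrow> (\<exists>\<sigma>\<in>transpositions n. g = \<sigma> \<circ> p)"
  proof
    assume *: "p \<circ> inv' g \<in> transpositions n"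
    have "g = (p \<circ> inv' g) \<circ> (p \<circ> inv' g) \<circ> g"
      using transpositions_involutory[OF *] by simp
    also have "\<dots> = (p \<circ> inv' g) \<circ> p"
      using permutes_inv_o(2)[OF assms(2)] by (simp add: comp_assoc)
    finally show "\<exists>\<sigma>\<in>transpositions n. g = \<sigma> \<circ> p"
      using * by blast
  next
    assume "\<exists>\<sigma>\<in>transpositions n. g = \<sigma> \<circ> p"
    then obtain \<sigma> where \<sigma>: "\<sigma> \<in> transpositions n" "g = \<sigma> \<circ> p"
      by blast
    have "p \<circ> inv' g = \<sigma> \<circ> \<sigma> \<circ> p \<circ> inv' g"
      using transpositions_involutory[OF \<sigma>(1)] by simp
    also have "\<dots> = \<sigma> \<circ> (g \<circ> inv' g)"
      unfolding \<sigma>(2) by (simp add: comp_assoc)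
    finally show "p \<circ> inv' g \<in> transpositions n"
      using \<sigma>(1) permutes_inv_o(1)[OF assms(2)] by simp
  qed
  finally show ?thesis .
qed

lemma graph_eigenvalue_transposition_graphI:
  fixes f :: "(nat \<Rightarrow> nat) \<Rightarrow> real"
  assumes nz: "p\<^sub>0 permutes {1..n}" "f p\<^sub>0 \<noteq> 0"
    and ev: "\<And>p. p permutes {1..n} \<Longrightarrow> (\<Sum>\<sigma>\<in>transpositions n. f (\<sigma> \<circ> p)) = k * f p"
  shows "graph_eigenvalue (transposition_graph n) k"
proof -
  define V where "V = {p. p permutes {1..n}}"
  have "finite V"
    unfolding V_def by (simp add: finite_permutations)
  then obtain vs where vs: "set vs = V" "distinct vs"
    using finite_distinct_list by blast
  let ?A = "adjacency_matrix (transposition_graph n) vs"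
  define N where "N = length vs"
  define v where "v = vec N (\<lambda>i. f (vs ! i))"
  have "v \<noteq> 0\<^sub>v N"
  proof -
    obtain i where "i < N" "vs ! i = p\<^sub>0"
      using nz(1) vs(1) unfolding V_def N_def by (metis in_set_conv_nth mem_Collect_eq)
    then have "v $ i \<noteq> 0\<^sub>v N $ i"
      using nz(2) by (simp add: v_def)
    then show ?thesis
      by metis
  qed
  moreover have "?A *\<^sub>v v = k \<cdot>\<^sub>v v"
  proof (rule eq_vecI)
    fix i assume "i < dim_vec (k \<cdot>\<^sub>v v)"
    then have i: "i < N"
      by (simp add: v_def)
    define p where "p = vs ! i"
    have p: "p permutes {1..n}"
      using i vs(1) nth_mem unfolding p_def N_def V_def by blast
    have "(?A *\<^sub>v v) $ i =
        (\<Sum>j = 0..<N. if (p, vs ! j) \<in> parcs (transposition_graph n) then f (vs ! j) else 0)"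
      using i by (auto simp: adjacency_matrix_def N_def v_def p_def scalar_prod_def intro!: sum.cong)
    also have "\<dots> = (\<Sum>g\<in>V. if (p, g) \<in> parcs (transposition_graph n) then f g else 0)"
      using sum.reindex_bij_betw[OF bij_betw_nth[OF vs(2) refl vs(1)[symmetric]]]
      by (simp add: N_def atLeast0LessThan)
    also have "\<dots> = (\<Sum>g | g \<in> V \<and> (p, g) \<in> parcs (transposition_graph n). f g)"
      using \<open>finite V\<close> by (simp add: sum.inter_filter)
    also have "{g. g \<in> V \<and> (p, g) \<in> parcs (transposition_graph n)} = (\<lambda>\<sigma>. \<sigma> \<circ> p) ` transpositions n"
      using parcs_transposition_graph[OF p] permutes_compose[OF p transpositions_permutes]
      unfolding V_def by auto
    also have "(\<Sum>g\<in>\<dots>. f g) = (\<Sum>\<sigma>\<in>transpositions n. f (\<sigma> \<circ> p))"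
    proof -
      have "inj_on (\<lambda>\<sigma>. \<sigma> \<circ> p) (transpositions n)"
        using permutes_surj[OF p] by (auto intro!: inj_onI simp: surj_fun_eq)
      then show ?thesis
        by (simp add: sum.reindex)
    qed
    also have "\<dots> = k * f p"
      by (rule ev[OF p])
    finally show "(?A *\<^sub>v v) $ i = (k \<cdot>\<^sub>v v) $ i"
      using i by (simp add: v_def p_def)
  qed (simp add: adjacency_matrix_def v_def N_def)
  ultimately have "eigenvalue ?A k"
    unfolding eigenvalue_def eigenvector_def
    by (intro exI[of _ v]) (simp add: adjacency_matrix_def v_def N_def carrier_vecI)
  moreover have "pverts (transposition_graph n) = V"
    by (simp add: transposition_graph_def cayley_graph_def sym_group_def V_def)
  ultimately show ?thesis
    unfolding graph_eigenvalue_def using vs by auto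
qed

section \<open>The symmetrizer of a tableau\<close>

text \<open>The tableau is an arbitrary bijective filling, not necessarily standard;
  \<open>pos\<close> sends an entry to its cell.\<close>

locale young_tableau =
  fixes n :: nat and Y :: "(nat \<times> nat) set" and pos :: "nat \<Rightarrow> nat \<times> nat"
  assumes young: "young_diagram Y"
    and pos: "bij_betw pos {1..n} Y"
begin

definition row :: "nat \<Rightarrow> nat" where "row x = fst (pos x)"
definition col :: "nat \<Rightarrow> nat" where "col x = snd (pos x)"

definition row_preserving :: "(nat \<Rightarrow> nat) \<Rightarrow> bool" where
  "row_preserving p \<longleftrightarrow> (\<forall>x\<in>{1..n}. row (p x) = row x)"

definition col_group :: "(nat \<Rightarrow> nat) set" where
  "col_group = {p. p permutes {1..n} \<and> (\<forall>x\<in>{1..n}. col (p x) = col x)}"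

text \<open>The eigenvector is \<open>symmetrizer id\<close>; the extra argument \<open>\<tau>\<close> isolates the contribution of a
  single transposition, as transpositions commute with the column group up to reordering.\<close>

definition symmetrizer :: "(nat \<Rightarrow> nat) \<Rightarrow> (nat \<Rightarrow> nat) \<Rightarrow> real" where
  "symmetrizer \<tau> p = (\<Sum>c\<in>col_group. of_int (sign c) * of_bool (row_preserving (\<tau> \<circ> c \<circ> p)))"

lemma inj_pos: "x \<in> {1..n} \<Longrightarrow> y \<in> {1..n} \<Longrightarrow> row x = row y \<Longrightarrow> col x = col y \<Longrightarrow> x = y"
  using pos unfolding bij_betw_def inj_on_def row_def col_def by (metis prod.expand)

text \<open>The shape of the diagram enters here: it provides the corner cell for
  \<open>symmetrizer_skew\<close> and the cells counted in \<open>card_row_pairs\<close> and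
  \<open>card_col_pairs\<close>.\<close>

lemma cell_exists:
  assumes "y \<in> {1..n}" "i \<le> row y" "j \<le> col y"
  obtains x where "x \<in> {1..n}" "row x = i" "col x = j"
proof -
  have "(row y, col y) \<in> Y"
    using pos assms(1) unfolding row_def col_def bij_betw_def by auto
  then have "(i, j) \<in> pos ` {1..n}"
    using young assms pos unfolding young_diagram_def bij_betw_def by blast
  then obtain x where "x \<in> {1..n}" "pos x = (i, j)"
    by auto
  then show thesis
    using that by (simp add: row_def col_def)
qed

lemma finite_col_group: "finite col_group"
  by (rule finite_subset[OF _ finite_permutations[of "{1..n}"]]) (auto simp: col_group_def)

lemma id_in_col_group: "id \<in> col_group"
  by (simp add: col_group_def permutes_id)

lemma col_groupD: "c \<in> col_group \<Longrightarrow> c permutes {1..n}"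
  by (simp add: col_group_def)

lemma transpose_in_col_group:
  assumes "x \<in> {1..n}" "y \<in> {1..n}" "col x = col y" "c \<in> col_group"
  shows "transpose x y \<circ> c \<in> col_group"
proof -
  have "col (transpose x y z) = col z" for z
    using assms(3) by (simp add: transpose_def)
  then show ?thesis
    using assms permutes_compose[OF _ permutes_swap_id[of x "{1..n}" y]] by (simp add: col_group_def)
qed

lemma row_preserving_transpose:
  assumes "row x = row y"
  shows "row_preserving (transpose x y \<circ> p) \<longleftrightarrow> row_preserving p"
proof -
  have "row (transpose x y z) = row z" for z
    using assms by (simp add: transpose_def)
  then show ?thesis
    by (simp add: row_preserving_def)
qed

text \<open>Left multiplication by the transposition is a sign-reversing involution of the column
  group.\<close>

lemma symmetrizer_comp_transpose:
  assumes "x \<in> {1..n}" "y \<in> {1..n}" "x \<noteq> y" "col x = col y"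
  shows "symmetrizer (\<tau> \<circ> transpose x y) p = - symmetrizer \<tau> p"
proof -
  let ?c = "transpose x y"
  have "symmetrizer \<tau> p =
      (\<Sum>c\<in>col_group. of_int (sign (?c \<circ> c)) * of_bool (row_preserving (\<tau> \<circ> (?c \<circ> c) \<circ> p)))"
    unfolding symmetrizer_def using assms
    by (intro sum.reindex_bij_witness[where i = "\<lambda>c. ?c \<circ> c" and j = "\<lambda>c. ?c \<circ> c"])
      (auto simp: transpose_in_col_group comp_assoc[symmetric])
  also have "\<dots> = (\<Sum>c\<in>col_group. - (of_int (sign c) * of_bool (row_preserving (\<tau> \<circ> ?c \<circ> c \<circ> p))))"
  proof (rule sum.cong)
    fix c assume "c \<in> col_group"
    then have "sign (?c \<circ> c) = - sign c"
      using assms(3) permutation_permutes[of c] col_groupD[of c]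
      by (subst sign_compose) (auto simp: permutation_swap_id sign_swap_id)
    then show "of_int (sign (?c \<circ> c)) * of_bool (row_preserving (\<tau> \<circ> (?c \<circ> c) \<circ> p)) =
        - (of_int (sign c) * of_bool (row_preserving (\<tau> \<circ> ?c \<circ> c \<circ> p)) :: real)"
      by (simp add: comp_assoc)
  qed simp
  finally show ?thesis
    unfolding symmetrizer_def by (simp add: sum_negf)
qed

lemma symmetrizer_row:
  assumes "row x = row y"
  shows "symmetrizer (transpose x y \<circ> \<tau>) p = symmetrizer \<tau> p"
  unfolding symmetrizer_def using row_preserving_transpose[OF assms] by (simp add: comp_assoc)

lemma symmetrizer_col:
  assumes "x \<in> {1..n}" "y \<in> {1..n}" "x \<noteq> y" "col x = col y"
  shows "symmetrizer (transpose x y) p = - symmetrizer id p"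
  using symmetrizer_comp_transpose[OF assms, of id] by simp

text \<open>The cell \<open>z\<close> in the row of \<open>x\<close> and the column of \<open>y\<close> lies in the diagram. Swapping \<open>z\<close> and \<open>y\<close>
  first negates the sum, but conjugated by the transposition \<open>(x y)\<close> it swaps \<open>z\<close> and \<open>x\<close>, which has
  no effect.\<close>

lemma symmetrizer_skew:
  assumes "x \<in> {1..n}" "y \<in> {1..n}" "row x < row y" "col x \<noteq> col y"
  shows "symmetrizer (transpose x y) p = 0"
proof -
  obtain z where z: "z \<in> {1..n}" "row z = row x" "col z = col y"
    using cell_exists[OF assms(2), of "row x" "col y"] assms(3) by auto
  have ne: "z \<noteq> y" "z \<noteq> x" "x \<noteq> y"
    using z assms by auto
  have "transpose x y \<circ> transpose z y = transpose z x \<circ> transpose x y"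
    using ne by (auto simp: fun_eq_iff transpose_def)
  then have "symmetrizer (transpose x y) p = - symmetrizer (transpose x y) p"
    using symmetrizer_comp_transpose[OF z(1) assms(2) ne(1) z(3), of "transpose x y" p]
      symmetrizer_row[OF z(2), of "transpose x y" p] by simp
  then show ?thesis
    by simp
qed

text \<open>Row and column stabilizers meet only in the identity, so a single summand survives. This
  makes the eigenvector nonzero.\<close>

lemma symmetrizer_id: "symmetrizer id id = 1"
proof -
  have "c = id" if "c \<in> col_group" "row_preserving c" for c
  proof
    fix x
    show "c x = id x"
    proof (cases "x \<in> {1..n}")
      case True
      then show ?thesis
        using that permutes_in_image[OF col_groupD[OF that(1)], of x]
        by (intro inj_pos[of "c x", simplified id_def[symmetric]])
          (auto simp: row_preserving_def col_group_def)
    next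
      case False
      then show ?thesis
        using permutes_not_in[OF col_groupD[OF that(1)]] by simp
    qed
  qed
  moreover have "row_preserving id"
    by (simp add: row_preserving_def)
  ultimately have "symmetrizer id id = (\<Sum>c\<in>col_group. if c = id then 1 else 0)"
    unfolding symmetrizer_def by (intro sum.cong) auto
  then show ?thesis
    using finite_col_group id_in_col_group by simp
qed

section \<open>Counting transpositions by type\<close>

text \<open>The three sets of pairs orient every transposition in exactly one way: by column within
  a row, by row otherwise.\<close>

definition row_pairs :: "(nat \<times> nat) set" where
  "row_pairs = {(x, y) \<in> {1..n} \<times> {1..n}. row x = row y \<and> col x < col y}"

definition col_pairs :: "(nat \<times> nat) set" where
  "col_pairs = {(x, y) \<in> {1..n} \<times> {1..n}. row x < row y \<and> col x = col y}"

definition skew_pairs :: "(nat \<times> nat) set" where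
  "skew_pairs = {(x, y) \<in> {1..n} \<times> {1..n}. row x < row y \<and> col x \<noteq> col y}"

lemma finite_pairs: "finite row_pairs" "finite col_pairs" "finite skew_pairs"
  unfolding row_pairs_def col_pairs_def skew_pairs_def
  by (rule finite_subset[of _ "{1..n} \<times> {1..n}"]; auto)+

lemma transpositions_eq_image:
  "transpositions n = (\<lambda>(x, y). transpose x y) ` (row_pairs \<union> col_pairs \<union> skew_pairs)" (is "_ = ?r")
proof
  show "transpositions n \<subseteq> ?r"
  proof
    fix \<sigma> assume "\<sigma> \<in> transpositions n"
    then obtain x y where xy: "\<sigma> = transpose x y" "x \<in> {1..n}" "y \<in> {1..n}" "x \<noteq> y"
      by (rule transpositionsE)
    let ?P = "row_pairs \<union> col_pairs \<union> skew_pairs"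
    have "row x \<noteq> row y \<or> col x \<noteq> col y"
      using inj_pos xy(2-4) by blast
    then have "(x, y) \<in> ?P \<or> (y, x) \<in> ?P"
      using xy(2,3) unfolding row_pairs_def col_pairs_def skew_pairs_def
      by (cases "row x" "row y" rule: linorder_cases; cases "col x" "col y" rule: linorder_cases) auto
    then show "\<sigma> \<in> ?r"
    proof
      assume "(x, y) \<in> ?P"
      then show ?thesis
        by (rule rev_image_eqI) (simp add: xy(1))
    next
      assume "(y, x) \<in> ?P"
      then show ?thesis
        by (rule rev_image_eqI) (simp add: xy(1) transpose_commute)
    qed
  qed
  show "?r \<subseteq> transpositions n"
    unfolding row_pairs_def col_pairs_def skew_pairs_def transpositions_def by auto
qed

lemma inj_on_transpose_pairs:
  "inj_on (\<lambda>(x, y). transpose x y) (row_pairs \<union> col_pairs \<union> skew_pairs)"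
proof (rule inj_onI, clarify)
  fix x y u v
  assume P: "(x, y) \<in> row_pairs \<union> col_pairs \<union> skew_pairs" "(u, v) \<in> row_pairs \<union> col_pairs \<union> skew_pairs"
    and eq: "transpose x y = transpose u v"
  have ne: "x \<noteq> y" "u \<noteq> v"
    using P unfolding row_pairs_def col_pairs_def skew_pairs_def by auto
  have "transpose u v x = y"
    using eq[symmetric] by simp
  with ne have "(x = u \<and> y = v) \<or> (x = v \<and> y = u)"
    by (cases "x = u"; cases "x = v") simp_all
  then show "x = u \<and> y = v"
  proof
    assume "x = v \<and> y = u"
    with P show ?thesis
      unfolding row_pairs_def col_pairs_def skew_pairs_def
      by (cases "row x" "row y" rule: linorder_cases) simp_all
  qed
qed

text \<open>For a fixed second entry \<open>y\<close>, the first entries are those to its left in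
  its row, one in each of the columns before \<open>col y\<close>.\<close>

lemma card_row_pairs: "card row_pairs = (\<Sum>y\<in>{1..n}. col y)"
proof -
  have "card {x \<in> {1..n}. row x = row y \<and> col x < col y} = col y" if y: "y \<in> {1..n}" for y
  proof -
    have "bij_betw col {x \<in> {1..n}. row x = row y \<and> col x < col y} {..<col y}"
      unfolding bij_betw_def
    proof
      show "inj_on col {x \<in> {1..n}. row x = row y \<and> col x < col y}"
        by (rule inj_onI, rule inj_pos) auto
      have "j \<in> col ` {x \<in> {1..n}. row x = row y \<and> col x < col y}" if "j < col y" for j
        using cell_exists[OF y, of "row y" j] that by force
      then show "col ` {x \<in> {1..n}. row x = row y \<and> col x < col y} = {..<col y}"
        by auto
    qed
    then show ?thesis
      using bij_betw_same_card by fastforce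
  qed
  moreover have "row_pairs = prod.swap ` (SIGMA y:{1..n}. {x \<in> {1..n}. row x = row y \<and> col x < col y})"
    unfolding row_pairs_def by (auto simp: image_iff)
  ultimately show ?thesis
    by (simp add: card_image)
qed

lemma card_col_pairs: "card col_pairs = (\<Sum>y\<in>{1..n}. row y)"
proof -
  have "card {x \<in> {1..n}. row x < row y \<and> col x = col y} = row y" if y: "y \<in> {1..n}" for y
  proof -
    have "bij_betw row {x \<in> {1..n}. row x < row y \<and> col x = col y} {..<row y}"
      unfolding bij_betw_def
    proof
      show "inj_on row {x \<in> {1..n}. row x < row y \<and> col x = col y}"
        by (rule inj_onI, rule inj_pos) auto
      have "j \<in> row ` {x \<in> {1..n}. row x < row y \<and> col x = col y}" if "j < row y" for j
        using cell_exists[OF y, of j "col y"] that by force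
      then show "row ` {x \<in> {1..n}. row x < row y \<and> col x = col y} = {..<row y}"
        by auto
    qed
    then show ?thesis
      using bij_betw_same_card by fastforce
  qed
  moreover have "col_pairs = prod.swap ` (SIGMA y:{1..n}. {x \<in> {1..n}. row x < row y \<and> col x = col y})"
    unfolding col_pairs_def by (auto simp: image_iff)
  ultimately show ?thesis
    by (simp add: card_image)
qed

lemma card_pairs_diff: "int (card row_pairs) - int (card col_pairs) = content_sum Y"
proof -
  have "content_sum Y = (\<Sum>x\<in>{1..n}. int (col x) - int (row x))"
    unfolding content_sum_def sum.reindex_bij_betw[OF pos, symmetric]
    by (simp add: row_def col_def case_prod_unfold)
  then show ?thesis
    by (simp add: card_row_pairs card_col_pairs sum_subtractf)
qed

lemma sum_symmetrizer:
  "(\<Sum>\<sigma>\<in>transpositions n. symmetrizer \<sigma> p) = of_int (content_sum Y) * symmetrizer id p"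
proof -
  define e where "e = symmetrizer id p"
  have "(\<Sum>\<sigma>\<in>transpositions n. symmetrizer \<sigma> p) =
      (\<Sum>(x, y)\<in>row_pairs \<union> col_pairs \<union> skew_pairs. symmetrizer (transpose x y) p)"
    unfolding transpositions_eq_image
    by (subst sum.reindex[OF inj_on_transpose_pairs]) (simp add: case_prod_unfold comp_def)
  also have "\<dots> = (\<Sum>(x, y)\<in>row_pairs. symmetrizer (transpose x y) p) +
      (\<Sum>(x, y)\<in>col_pairs. symmetrizer (transpose x y) p) +
      (\<Sum>(x, y)\<in>skew_pairs. symmetrizer (transpose x y) p)"
    using finite_pairs
    by (subst sum.union_disjoint; (subst sum.union_disjoint)?)
      (auto simp: row_pairs_def col_pairs_def skew_pairs_def)
  also have "(\<Sum>(x, y)\<in>row_pairs. symmetrizer (transpose x y) p) =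
      (\<Sum>(x, y)\<in>row_pairs. e)"
    using symmetrizer_row[of _ _ id] by (intro sum.cong) (auto simp: row_pairs_def e_def)
  also have "(\<Sum>(x, y)\<in>col_pairs. symmetrizer (transpose x y) p) =
      (\<Sum>(x, y)\<in>col_pairs. - e)"
    by (intro sum.cong) (auto simp: col_pairs_def e_def intro!: symmetrizer_col)
  also have "(\<Sum>(x, y)\<in>skew_pairs. symmetrizer (transpose x y) p) = (\<Sum>(x, y)\<in>skew_pairs. 0)"
    by (intro sum.cong) (auto simp: skew_pairs_def intro!: symmetrizer_skew)
  finally have "(\<Sum>\<sigma>\<in>transpositions n. symmetrizer \<sigma> p) =
      of_int (int (card row_pairs) - int (card col_pairs)) * e"
    by (simp add: case_prod_unfold algebra_simps)
  then show ?thesis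
    by (simp only: card_pairs_diff e_def)
qed

lemma graph_eigenvalue_content_sum:
  "graph_eigenvalue (transposition_graph n) (of_int (content_sum Y))"
proof (rule graph_eigenvalue_transposition_graphI[where f = "symmetrizer id" and p\<^sub>0 = id])
  show "id permutes {1..n}" "symmetrizer id id \<noteq> 0"
    by (simp_all add: permutes_id symmetrizer_id)
  fix p assume "p permutes {1..n}"
  have "(\<Sum>\<sigma>\<in>transpositions n. symmetrizer id (\<sigma> \<circ> p)) =
      (\<Sum>c\<in>col_group. of_int (sign c) *
        (\<Sum>\<sigma>\<in>transpositions n. of_bool (row_preserving (c \<circ> \<sigma> \<circ> p))))"
    unfolding symmetrizer_def by (subst sum.swap) (simp add: sum_distrib_left comp_assoc)
  \<comment> \<open>For each fixed \<open>c\<close>, centrality moves the transposition to the left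
    of \<open>c\<close>, where it becomes the first argument of \<open>symmetrizer\<close>.\<close>
  also have "\<dots> = (\<Sum>c\<in>col_group. of_int (sign c) *
        (\<Sum>\<sigma>\<in>transpositions n. of_bool (row_preserving (\<sigma> \<circ> c \<circ> p))))"
    by (rule sum.cong[OF refl], rule arg_cong[where f = "(*) _"],
        rule sum_transpositions_comp_commute[OF col_groupD])
  also have "\<dots> = (\<Sum>\<sigma>\<in>transpositions n. symmetrizer \<sigma> p)"
    unfolding symmetrizer_def by (subst sum.swap) (simp add: sum_distrib_left)
  finally show "(\<Sum>\<sigma>\<in>transpositions n. symmetrizer id (\<sigma> \<circ> p)) =
      of_int (content_sum Y) * symmetrizer id p"
    by (simp only: sum_symmetrizer)
qed

end

section \<open>From content sums to the interval of eigenvalues\<close>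

lemma graph_eigenvalue_box_content:
  assumes "box_content a b n s"
  shows "graph_eigenvalue (transposition_graph n) (of_int s)"
proof -
  obtain Y where Y: "young_diagram Y" "card Y = n" "content_sum Y = s"
    using assms by (rule box_contentE)
  then have "finite Y" "card {1..n} = card Y"
    by (simp_all add: young_diagram_def)
  then obtain pos where "bij_betw pos {1..n} Y"
    using bij_betw_iff_card[of "{1..n}" Y] by auto
  with Y(1) interpret young_tableau n Y pos
    by unfold_locales
  show ?thesis
    using graph_eigenvalue_content_sum Y(3) by simp
qed

theorem theorem1p3:
  fixes n :: nat and k :: int
  assumes "n \<ge> 76"
    and "k \<in> {- int (((2 * n + 1) div 3) choose 2) .. int (((2 * n + 1) div 3) choose 2)}"
  shows "graph_eigenvalue (transposition_graph n) (real_of_int k)"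
proof -
  have "\<bar>k\<bar> \<le> int (((2 * n + 1) div 3) choose 2)"
    using assms(2) by (auto simp: abs_le_iff)
  then obtain a b where ab: "box_content a b n \<bar>k\<bar>"
    using box_content_exists[OF assms(1), of "\<bar>k\<bar>"] by auto
  \<comment> \<open>Negative \<open>k\<close> come from the transposed diagram.\<close>
  have "\<exists>a b. box_content a b n k"
    using ab box_content_transpose[OF ab] by (cases "0 \<le> k") auto
  then show ?thesis
    using graph_eigenvalue_box_content by blast
qed

end
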